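(* Let $p(x)=x^4+ax^3+bx^2+cx+d$ be a real quartic polynomial and let $t_u=\frac{a^2}{16}-\frac b6-\frac1{16}(a^3-4ab+8c)^{2/3}$. (i) If $t_u\le 0$, then $p$ has only one critical point. (ii) If $t_u>0$, then $p$ has three distinct critical points. In this case: (a) if all the critical points $x$ of $p$ satisfy $x\neq-\frac a4$, then solving the differential equation $$\frac{dx(t)}{dt}=-\frac{12x+3a}{12x^2+6ax+2b+12t}$$ backward from $t=t_u$ to $t=0$, with the condition $$x(t_u)=-\frac a4-\frac{(a^3-4ab+8c)^{1/3}}{2}$$ at $t=t_u$, attains the global minimizer of $p$ at $t=0$, i.e. $x(0)$ is the global minimizer of $p$; (b) if one critical point of $p$ equals $-\frac a4$, then $p$ has two global minimizers, and they are the roots of the quadratic polynomial $\dfrac{p'(x)}{x+\frac a4}$.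
   Context: $y^{1/3}$ denotes the real cube root of $y\in\mathbb{R}$, and $y^{2/3}=(y^{1/3})^2$. Critical points are real zeros of $p'$.
   Formalization: Part (i) fails when t_u = 0 and a^3-4ab+8c ≠ 0 (e.g. a=0, b=-6, c=8, d=0: p' = 4(x-1)^2(x+2)); in exactly that case it is replaced by: p has two critical points, exactly one of which is a local extremum. *)

theory Defs
  imports Complex_Main "HOL-Computational_Algebra.Polynomial"
begin

definition quartic :: "real \<Rightarrow> real \<Rightarrow> real \<Rightarrow> real \<Rightarrow> real poly" where
  "quartic a b c d = [:d, c, b, a, 1:]"

definition critical_points :: "real poly \<Rightarrow> real set" where
  "critical_points p = {x. poly (pderiv p) x = 0}"

definition global_minimizers :: "real poly \<Rightarrow> real set" where
  "global_minimizers p = {x. \<forall>y. poly p x \<le> poly p y}"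

definition local_extremum :: "real poly \<Rightarrow> real \<Rightarrow> bool" where
  "local_extremum p x \<longleftrightarrow>
     (\<forall>\<^sub>F y in nhds x. poly p x \<le> poly p y) \<or> (\<forall>\<^sub>F y in nhds x. poly p y \<le> poly p x)"

definition cubic_coeff :: "real \<Rightarrow> real \<Rightarrow> real \<Rightarrow> real" where
  "cubic_coeff a b c = a^3 - 4*a*b + 8*c"

text \<open>The library's \<^term>\<open>root 3\<close> is the real cube root, also for negative arguments.\<close>

definition t_u :: "real \<Rightarrow> real \<Rightarrow> real \<Rightarrow> real" where
  "t_u a b c = a^2 / 16 - b / 6 - (root 3 (cubic_coeff a b c))^2 / 16"

text \<open>
  A solution must keep the denominator of the right-hand side nonzero; without this
  the convention \<^prop>\<open>z / 0 = (0::real)\<close> would give the equation a meaning where it has none.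
  The derivative is one-sided at both ends of the time interval.
\<close>

definition flow_solution :: "real \<Rightarrow> real \<Rightarrow> real \<Rightarrow> (real \<Rightarrow> real) \<Rightarrow> bool" where
  "flow_solution a b T x \<longleftrightarrow>
     (\<forall>t\<in>{0..T}.
        12 * (x t)^2 + 6*a * x t + 2*b + 12*t \<noteq> 0 \<and>
        (x has_real_derivative
           - ((12 * x t + 3*a) / (12 * (x t)^2 + 6*a * x t + 2*b + 12*t)))
          (at t within {0..T}))"

text \<open>
  For \<^prop>\<open>t_u a b c = 0\<close> the cubic \<open>p'\<close> has a double zero, which differs from its simple
  zero unless \<^prop>\<open>cubic_coeff a b c = 0\<close>. In that boundary case \<open>p\<close> has two
  critical points, one of them a horizontal inflection point, so ``one critical point for
  every \<open>t_u \<le> 0\<close>'' fails there, as the following instance shows.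
\<close>

lemma boundary_two_critical_points:
  "t_u 0 (-6) 8 = 0" "critical_points (quartic 0 (-6) 8 0) = {1, -2}"
proof -
  have "root 3 (64::real) = 4"
    using real_root_power_cancel[of 3 "4::real"] by simp
  then show "t_u 0 (-6) 8 = 0"
    by (simp add: t_u_def cubic_coeff_def)
  have "poly (pderiv (quartic 0 (-6) 8 0)) x = 4 * (x - 1)^2 * (x + 2)" for x
    by (simp add: quartic_def pderiv_pCons algebra_simps power2_eq_square)
  then show "critical_points (quartic 0 (-6) 8 0) = {1, -2}"
    by (auto simp: critical_points_def add_eq_0_iff2)
qed

end

theory Submission imports Defs begin

text \<open>
  Substituting \<open>x = z - a / 4\<close> and writing \<open>k\<close> for the cube root of \<open>a\<^sup>3 - 4ab + 8c\<close> turns \<open>p'\<close> into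
  \<open>4 z\<^sup>3 - (12 t\<^sub>u + 3 k\<^sup>2 / 4) z + k\<^sup>3 / 8\<close>. For \<open>k \<noteq> 0\<close> it has exactly one zero
  \<open>z\<^sub>0 = - k w\<close> with \<open>w > 0\<close>, given by \<open>branch w = t\<^sub>u / k\<^sup>2\<close> for an increasing bijection \<open>branch\<close> of the
  positive reals onto the reals; the other two zeros solve a quadratic equation whose discriminant
  has the sign of \<open>w - 1 / 2\<close>, that is, of \<open>t\<^sub>u\<close>. Moreover
  \<open>p(z) - p(z\<^sub>0) = (z - z\<^sub>0)\<^sup>2 ((z + z\<^sub>0)\<^sup>2 - k\<^sup>3 / (16 z\<^sub>0))\<close>, so a critical point
  on the side of \<open>- a / 4\<close> opposite to \<open>k\<close> is the strict global minimizer.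
  The differential equation says that \<open>p'(x) + 12 t (x + a / 4)\<close> is conserved. It vanishes at the
  initial point but equals \<open>k\<^sup>3 / 8\<close> at \<open>x = - a / 4\<close>, so the trajectory stays on the side
  opposite to \<open>k\<close> and ends at that minimizer.
\<close>

section \<open>An increasing rational function on the positive axis and its inverse\<close>

definition branch :: "real \<Rightarrow> real" where
  "branch w = w^2 / 3 - 1 / 16 - 1 / (96 * w)"

text \<open>The restriction to \<open>w > 0\<close> makes the description unique: on the negative
  axis \<open>branch\<close> tends to infinity at both ends, so it is not injective there.\<close>

definition inv_branch :: "real \<Rightarrow> real" where
  "inv_branch s = (THE w. w > 0 \<and> branch w = s)"

lemma branch_strict_mono: "0 < v \<Longrightarrow> v < w \<Longrightarrow> branch v < branch w"
proof -
  assume "0 < v" "v < w"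
  then have "v^2 < w^2" "1 / (96 * w) < 1 / (96 * v)"
    by (auto intro!: power_strict_mono simp: field_simps)
  then show ?thesis by (simp add: branch_def)
qed

lemma branch_half: "branch (1 / 2) = 0"
  by (simp add: branch_def power2_eq_square)

lemma isCont_branch: "w > 0 \<Longrightarrow> isCont branch w"
  unfolding branch_def by (intro continuous_intros) auto

lemma DERIV_branch: "w > 0 \<Longrightarrow> DERIV branch w :> 2 * w / 3 + 1 / (96 * w^2)"
  unfolding branch_def
  by (auto intro!: derivative_eq_intros simp: field_simps power2_eq_square)

lemma branch_surj: "\<exists>w>0. branch w = s"
proof -
  \<comment> \<open>Chosen so that the pole term of \<open>branch u\<close> is exactly
    \<open>- (\<bar>s\<bar> + 1)\<close>; \<open>v\<close> is large enough for the linear bound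
    \<open>2 * v \<le> v^2\<close> to lift \<open>branch v\<close> above \<open>s\<close>.\<close>
  define u where "u = 1 / (96 * (\<bar>s\<bar> + 1))"
  define v where "v = 3 * \<bar>s\<bar> + 2"
  have u: "u > 0" "u \<le> 1 / 96" by (auto simp: u_def field_simps)
  have "u^2 \<le> 1 / 96 * (1 / 96)" unfolding power2_eq_square using u by (intro mult_mono) auto
  moreover have "1 / (96 * u) = \<bar>s\<bar> + 1" by (simp add: u_def)
  ultimately have lo: "branch u \<le> s" by (simp add: branch_def)
  have v: "v \<ge> 2" by (simp add: v_def)
  have "2 * v \<le> v^2" unfolding power2_eq_square using v by (intro mult_right_mono) auto
  moreover have "1 / (96 * v) \<le> 1 / 96" using v by (simp add: field_simps)
  ultimately have "2 * v / 3 - 1 / 16 - 1 / 96 \<le> branch v" by (simp add: branch_def)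
  moreover have "s \<le> 2 * v / 3 - 1 / 16 - 1 / 96" by (simp add: v_def field_simps)
  ultimately have hi: "s \<le> branch v" by linarith
  have "u \<le> v" using u v by simp
  moreover have "\<forall>w. u \<le> w \<and> w \<le> v \<longrightarrow> isCont branch w" using u isCont_branch by auto
  ultimately obtain w where "u \<le> w" "branch w = s" using IVT[of branch u s v, OF lo hi] by blast
  then show ?thesis using u by (intro exI[of _ w]) auto
qed

lemma branch_inj: "0 < v \<Longrightarrow> 0 < w \<Longrightarrow> branch v = branch w \<Longrightarrow> v = w"
  by (metis branch_strict_mono less_irrefl linorder_less_linear)

lemma inv_branch: "inv_branch s > 0" "branch (inv_branch s) = s"
proof -
  have "\<exists>!w. w > 0 \<and> branch w = s" using branch_surj branch_inj by metis
  from theI'[OF this] show "inv_branch s > 0" "branch (inv_branch s) = s"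
    by (auto simp: inv_branch_def)
qed

lemma inv_branch_branch: "w > 0 \<Longrightarrow> inv_branch (branch w) = w"
  using branch_inj inv_branch by metis

lemma DERIV_inv_branch:
  "DERIV inv_branch s :> inverse (2 * inv_branch s / 3 + 1 / (96 * (inv_branch s)^2))"
proof (rule DERIV_inverse_function[where f = branch and a = "s - 1" and b = "s + 1"])
  define w where "w = inv_branch s"
  have w: "w > 0" "branch w = s" by (auto simp: w_def inv_branch)
  show "DERIV branch (inv_branch s) :> 2 * inv_branch s / 3 + 1 / (96 * (inv_branch s)^2)"
    by (rule DERIV_branch) (rule inv_branch)
  show "2 * inv_branch s / 3 + 1 / (96 * (inv_branch s)^2) \<noteq> 0"
    using inv_branch(1)[of s] by (intro less_imp_neq[symmetric] add_pos_pos) auto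
  \<comment> \<open>The closed interval of radius \<open>w / 2\<close> around \<open>w\<close> stays
    positive, so \<open>inv_branch\<close> really inverts \<open>branch\<close> on it and is
    continuous at \<open>branch w\<close>.\<close>
  have "0 < v" if "\<bar>v - w\<bar> \<le> w / 2" for v using that w(1) by linarith
  then have "isCont inv_branch (branch w)"
    using w(1) inv_branch_branch isCont_branch
    by (intro isCont_inverse_function[where f = branch and x = w and d = "w / 2"]) (rule half_gt_zero, blast+)
  then show "isCont inv_branch s" using w by simp
qed (auto simp: inv_branch)

section \<open>Coordinates centred at \<open>- a / 4\<close>\<close>

locale depressed =
  fixes a b c d k T :: real
  assumes k_def: "k = root 3 (cubic_coeff a b c)"
    and T_def: "T = t_u a b c"
begin

text \<open>Together with \<open>b_eq\<close> this eliminates the cube root: later identities become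
  rational ones in \<open>a\<close>, \<open>k\<close>, \<open>T\<close> and the variables.\<close>

lemma c_eq: "c = k^3 / 8 - a^3 / 8 + a * b / 2"
proof -
  have "k^3 = cubic_coeff a b c" unfolding k_def by (rule odd_real_root_pow) simp
  then show ?thesis by (simp add: cubic_coeff_def field_simps)
qed

lemma b_eq: "b = 3 * a^2 / 8 - 6 * T - 3 * k^2 / 8"
  unfolding T_def t_u_def k_def by simp

text \<open>The parameter \<open>s\<close> serves two purposes: \<open>s = T\<close> gives
  \<open>p'\<close>, and \<open>s = T - t\<close> gives the quantity conserved by the differential
  equation.\<close>

definition rho :: "real \<Rightarrow> real \<Rightarrow> real" where
  "rho s z = 4 * z^3 - (12 * s + 3 * k^2 / 4) * z + k^3 / 8"

lemma poly_pderiv_shift: "poly (pderiv (quartic a b c d)) (z - a / 4) = rho T z"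
  unfolding rho_def quartic_def c_eq
  by (simp add: pderiv_pCons b_eq field_simps power2_eq_square power3_eq_cube)

lemma poly_shift:
  "poly (quartic a b c d) (z - a / 4) =
    z^4 - (6 * T + 3 * k^2 / 8) * z^2 + k^3 / 8 * z + poly (quartic a b c d) (- a / 4)"
  unfolding quartic_def c_eq
  by (simp add: b_eq field_simps power2_eq_square power3_eq_cube power4_eq_xxxx)

text \<open>The right-hand side is the derivative of \<open>rho (T - t)\<close> at
  \<open>x + a / 4\<close>.\<close>

lemma denominator_shift:
  "12 * x^2 + 6 * a * x + 2 * b + 12 * t = 12 * (x + a / 4)^2 - 12 * (T - t) - 3 * k^2 / 4"
  by (simp add: b_eq field_simps power2_eq_square)

lemma critical_points_eq: "critical_points (quartic a b c d) = (\<lambda>z. z - a / 4) ` {z. rho T z = 0}"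
proof (intro set_eqI iffI)
  fix x assume "x \<in> critical_points (quartic a b c d)"
  then have "rho T (x + a / 4) = 0"
    using poly_pderiv_shift[of "x + a / 4"] by (simp add: critical_points_def)
  then show "x \<in> (\<lambda>z. z - a / 4) ` {z. rho T z = 0}"
    by (intro image_eqI[of _ _ "x + a / 4"]) auto
qed (auto simp: critical_points_def poly_pderiv_shift)

lemma card_critical_points: "card (critical_points (quartic a b c d)) = card {z. rho T z = 0}"
  unfolding critical_points_eq by (rule card_image) (auto simp: inj_on_def)

text \<open>This is where \<open>branch\<close> comes from: solve \<open>rho s (- k * w) = 0\<close>
  for \<open>s\<close> and divide by \<open>k^2\<close>.\<close>

lemma rho_branch: "w \<noteq> 0 \<Longrightarrow> rho (k^2 * branch w) (- k * w) = 0"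
  by (simp add: rho_def branch_def field_simps power2_eq_square power3_eq_cube)

text \<open>A critical point is a double zero of the difference. The missing cubic term and the
  linear coefficient \<open>k^3 / 8\<close> then fix the remaining quadratic factor.\<close>

lemma poly_diff_critical:
  assumes "rho T z0 = 0" "z0 \<noteq> 0"
  shows "poly (quartic a b c d) (z - a / 4) - poly (quartic a b c d) (z0 - a / 4) =
    (z - z0)^2 * ((z + z0)^2 - k^3 / (16 * z0))"
proof -
  define q where "q = k^3 / (16 * z0)"
  have kk: "k^3 = 16 * z0 * q" using assms by (simp add: q_def)
  have "12 * T + 3 * k^2 / 4 = 4 * z0^2 + 2 * q"
  proof -
    have "z0 * (12 * T + 3 * k^2 / 4) = z0 * (4 * z0^2 + 2 * q)"
      using assms(1) unfolding rho_def kk by (simp add: algebra_simps power2_eq_square power3_eq_cube)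
    then show ?thesis using assms(2) by simp
  qed
  then have "6 * T + 3 * k^2 / 8 = 2 * z0^2 + q" by simp
  then show ?thesis unfolding poly_shift q_def[symmetric] unfolding kk
    by (simp add: field_simps power2_eq_square power4_eq_xxxx)
qed

lemma global_minimizers_opposite:
  assumes "rho T z0 = 0" "z0 * k < 0"
  shows "global_minimizers (quartic a b c d) = {z0 - a / 4}"
proof -
  have z0: "z0 \<noteq> 0" using assms by auto
  have neg: "k^3 / (16 * z0) < 0"
    using assms(2) by (auto simp: divide_less_0_iff mult_less_0_iff zero_less_power_eq power_less_zero_eq)
  have less: "poly (quartic a b c d) (z0 - a / 4) < poly (quartic a b c d) y" if "y \<noteq> z0 - a / 4" for y
  proof -
    have "0 < (y + a / 4 - z0)^2 * ((y + a / 4 + z0)^2 - k^3 / (16 * z0))"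
      using that neg by (intro mult_pos_pos) (auto intro: less_le_trans)
    then show ?thesis using poly_diff_critical[OF assms(1) z0, of "y + a / 4"] by simp
  qed
  have le: "poly (quartic a b c d) (z0 - a / 4) \<le> poly (quartic a b c d) y" for y
    using less[of y] by (cases "y = z0 - a / 4") auto
  have "y = z0 - a / 4" if "poly (quartic a b c d) y \<le> poly (quartic a b c d) (z0 - a / 4)" for y
    using less[of y] that by force
  with le show ?thesis by (auto simp: global_minimizers_def)
qed

section \<open>Number of critical points\<close>

lemma zeros_eq:
  assumes "k \<noteq> 0" "w > 0" "T = k^2 * branch w"
  shows "{z. rho T z = 0} = insert (- k * w) {z. (z - k * w / 2)^2 = k^2 * (w^3 - 1 / 8) / (4 * w)}"
proof -
  \<comment> \<open>Split off the known zero \<open>- k * w\<close> and complete the square in the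
    quotient; the sign of \<open>w^3 - 1 / 8\<close> decides whether it has real zeros.\<close>
  have "rho T z = 4 * (z + k * w) * ((z - k * w / 2)^2 - k^2 * (w^3 - 1 / 8) / (4 * w))" for z
    using assms(2) unfolding rho_def assms(3) branch_def
    by (simp add: field_simps power2_eq_square power3_eq_cube)
  then show ?thesis by (auto simp: add_eq_0_iff2)
qed

lemma branch_obtain:
  assumes "k \<noteq> 0"
  obtains w where "w > 0" "T = k^2 * branch w" "w > 1 / 2 \<longleftrightarrow> T > 0" "w < 1 / 2 \<longleftrightarrow> T < 0"
proof
  define w where "w = inv_branch (T / k^2)"
  show w: "w > 0" "T = k^2 * branch w" using assms inv_branch by (auto simp: w_def)
  have "branch w > 0" if "w > 1 / 2" using branch_strict_mono[of "1/2" w] that by (simp add: branch_half)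
  moreover have "branch w < 0" if "w < 1 / 2"
    using branch_strict_mono[of w "1/2"] that w by (simp add: branch_half)
  moreover have "w = 1 / 2 \<Longrightarrow> branch w = 0" by (simp only: branch_half)
  ultimately have "w > 1 / 2 \<longleftrightarrow> branch w > 0" "w < 1 / 2 \<longleftrightarrow> branch w < 0"
    by (metis less_asym less_irrefl linorder_less_linear)+
  moreover have "k^2 > 0" using assms by simp
  ultimately show "w > 1 / 2 \<longleftrightarrow> T > 0" "w < 1 / 2 \<longleftrightarrow> T < 0"
    unfolding w(2) by (auto simp: zero_less_mult_iff mult_less_0_iff)
qed

lemma card_zeros_one:
  assumes "T < 0 \<or> T = 0 \<and> k = 0"
  shows "card {z. rho T z = 0} = 1"
proof (cases "k = 0")
  case True
  have "rho T z = 4 * z * (z^2 - 3 * T)" for z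
    unfolding rho_def using True by (simp add: algebra_simps power2_eq_square power3_eq_cube)
  moreover have "z = 0" if "z^2 = 3 * T" for z
    using assms that zero_le_power2[of z] by (cases "T = 0") auto
  ultimately have "{z. rho T z = 0} = {0}" by auto
  then show ?thesis by simp
next
  case False
  then obtain w where w: "w > 0" "T = k^2 * branch w" "w < 1 / 2"
    using branch_obtain assms by metis
  have "w^3 < (1 / 2)^3" using w by (intro power_strict_mono) auto
  then have "k^2 * (w^3 - 1 / 8) < 0"
    using False by (intro mult_pos_neg) (auto simp: power3_eq_cube)
  then have "k^2 * (w^3 - 1 / 8) / (4 * w) < 0" using w by (intro divide_neg_pos) auto
  then have "{z. (z - k * w / 2)^2 = k^2 * (w^3 - 1 / 8) / (4 * w)} = {}"
    by (metis (mono_tags, lifting) Collect_empty_eq not_le zero_le_power2)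
  then have "{z. rho T z = 0} = {- k * w}" using zeros_eq[OF False w(1,2)] by simp
  then show ?thesis by simp
qed

lemma card_zeros_three:
  assumes "T > 0"
  shows "card {z. rho T z = 0} = 3"
proof -
  have sq: "{z. (z - u)^2 = v} = {u + sqrt v, u - sqrt v}" if "v > 0" for u v :: real
  proof -
    have "(z - u)^2 = v \<longleftrightarrow> z = u + sqrt v \<or> z = u - sqrt v" for z
      using power2_eq_iff[of "z - u" "sqrt v"] that by auto
    then show ?thesis by auto
  qed
  \<comment> \<open>Both cases take the form of a linear factor times a quadratic with two real
    zeros; the last condition keeps \<open>r\<close> apart from those two.\<close>
  obtain r u v where z: "{z. rho T z = 0} = insert r {z. (z - u)^2 = v}" "v > 0" "(r - u)^2 \<noteq> v"
  proof (cases "k = 0")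
    case True
    have "rho T z = 4 * z * (z^2 - 3 * T)" for z
      unfolding rho_def using True by (simp add: algebra_simps power2_eq_square power3_eq_cube)
    then have "{z. rho T z = 0} = insert 0 {z. (z - 0)^2 = 3 * T}" by auto
    then show ?thesis by (rule that) (use assms in auto)
  next
    case False
    then obtain w where w: "w > 0" "T = k^2 * branch w" "w > 1 / 2"
      using branch_obtain assms by metis
    have "(1 / 2)^3 < w^3" using w by (intro power_strict_mono) auto
    then have "0 < k^2 * (w^3 - 1 / 8) / (4 * w)"
      using False w by (intro divide_pos_pos mult_pos_pos) (auto simp: power3_eq_cube)
    moreover have "(- k * w - k * w / 2)^2 - k^2 * (w^3 - 1 / 8) / (4 * w) = k^2 * (2 * w^2 + 1 / (32 * w))"
      using w(1) by (simp add: field_simps power2_eq_square power3_eq_cube)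
    moreover have "k^2 * (2 * w^2 + 1 / (32 * w)) > 0"
      using False w(1) by (intro mult_pos_pos add_pos_pos) auto
    ultimately show ?thesis using zeros_eq[OF False w(1,2)] by (intro that) auto
  qed
  have "r \<noteq> u + sqrt v" "r \<noteq> u - sqrt v" using z(2,3) by auto
  moreover have "u + sqrt v \<noteq> u - sqrt v" using z(2) by simp
  ultimately show ?thesis unfolding z(1) sq[OF z(2)] by simp
qed

section \<open>The boundary case \<open>T = 0\<close>\<close>

lemma boundary_zeros:
  assumes "T = 0" shows "{z. rho T z = 0} = {- k / 2, k / 4}"
proof -
  have "rho T z = 4 * (z + k / 2) * (z - k / 4)^2" for z
    unfolding rho_def assms by (simp add: field_simps power2_eq_square power3_eq_cube)
  then show ?thesis by (auto simp: add_eq_0_iff2)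
qed

text \<open>At the double zero \<open>k / 4\<close> of \<open>p'\<close> the increment of
  \<open>p\<close> is of third order, hence changes sign.\<close>

lemma boundary_not_extremum:
  assumes "T = 0" "k \<noteq> 0"
  shows "\<not> local_extremum (quartic a b c d) (k / 4 - a / 4)"
proof
  let ?p = "poly (quartic a b c d)"
  have root: "rho T (k / 4) = 0" using boundary_zeros[OF assms(1)] by blast
  \<comment> \<open>Scaling the increment by \<open>k\<close> leaves the even power
    \<open>k^4\<close>, so the sign of \<open>k\<close> does not matter.\<close>
  have diff: "?p (k / 4 - a / 4 + k * e) - ?p (k / 4 - a / 4) = k^4 * e^3 * (e + 1)" for e
  proof -
    have quot: "k^3 / (16 * (k / 4)) = k^2 / 4"
      using assms(2) by (simp add: power3_eq_cube power2_eq_square)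
    have eq: "k / 4 - a / 4 + k * e = k / 4 + k * e - a / 4" by simp
    have "?p (k / 4 - a / 4 + k * e) - ?p (k / 4 - a / 4) =
        (k / 4 + k * e - k / 4)^2 * ((k / 4 + k * e + k / 4)^2 - k^2 / 4)"
      unfolding eq quot[symmetric]
      using assms(2) by (intro poly_diff_critical[OF root]) simp
    also have "\<dots> = k^4 * e^3 * (e + 1)"
      by (simp add: field_simps power2_eq_square power3_eq_cube power4_eq_xxxx)
    finally show ?thesis .
  qed
  have lim: "((\<lambda>e. k / 4 - a / 4 + k * e) \<longlongrightarrow> k / 4 - a / 4) (at 0)"
    by (auto intro!: tendsto_eq_intros)
  have k4: "k^4 > 0" using assms(2) by simp
  assume "local_extremum (quartic a b c d) (k / 4 - a / 4)"
  then consider "\<forall>\<^sub>F y in nhds (k / 4 - a / 4). ?p (k / 4 - a / 4) \<le> ?p y"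
    | "\<forall>\<^sub>F y in nhds (k / 4 - a / 4). ?p y \<le> ?p (k / 4 - a / 4)"
    by (auto simp: local_extremum_def)
  then show False
  proof cases
    case 1
    then have "\<forall>\<^sub>F e in at 0. k^4 * e^3 * (e + 1) \<ge> 0"
      using eventually_compose_filterlim[OF _ lim] diff by (smt (verit) eventually_mono)
    then obtain r where r: "r > 0" "\<And>e. e \<noteq> 0 \<Longrightarrow> dist e 0 < r \<Longrightarrow> k^4 * e^3 * (e + 1) \<ge> 0"
      by (auto simp: eventually_at)
    \<comment> \<open>The bound \<open>1 / 2\<close> keeps the factor \<open>1 - e\<close> positive
      at the increment \<open>- e\<close>.\<close>
    define e where "e = min (r / 2) (1 / 2)"
    have e: "e > 0" "e < r" "e < 1" using r(1) by (auto simp: e_def)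
    have "k^4 * e^3 * (1 - e) > 0" using k4 e by (intro mult_pos_pos) auto
    then show False using r(2)[of "- e"] e by simp
  next
    case 2
    then have "\<forall>\<^sub>F e in at 0. k^4 * e^3 * (e + 1) \<le> 0"
      using eventually_compose_filterlim[OF _ lim] diff by (smt (verit) eventually_mono)
    then obtain r where r: "r > 0" "\<And>e. e \<noteq> 0 \<Longrightarrow> dist e 0 < r \<Longrightarrow> k^4 * e^3 * (e + 1) \<le> 0"
      by (auto simp: eventually_at)
    have "k^4 * (r / 2)^3 * (r / 2 + 1) > 0" using k4 r(1) by (intro mult_pos_pos) auto
    then show False using r(2)[of "r / 2"] r(1) by simp
  qed
qed

text \<open>The simple zero \<open>- k / 2\<close> lies opposite to \<open>k\<close>, so it gives
  the global minimizer; the double zero gives an inflection point.\<close>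

lemma boundary_unique_extremum:
  assumes "T = 0" "k \<noteq> 0"
  shows "\<exists>!x. x \<in> critical_points (quartic a b c d) \<and> local_extremum (quartic a b c d) x"
proof -
  have "rho T (- k / 2) = 0" using boundary_zeros[OF assms(1)] by blast
  moreover have "- k / 2 * k < 0" using assms(2) by (auto simp: zero_less_mult_iff linorder_neq_iff)
  ultimately have "global_minimizers (quartic a b c d) = {- k / 2 - a / 4}"
    by (rule global_minimizers_opposite)
  then have "local_extremum (quartic a b c d) (- k / 2 - a / 4)"
    unfolding local_extremum_def global_minimizers_def by (auto intro!: disjI1 always_eventually)
  moreover have "critical_points (quartic a b c d) = {- k / 2 - a / 4, k / 4 - a / 4}"
    unfolding critical_points_eq boundary_zeros[OF assms(1)] by simp
  ultimately show ?thesis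
    using boundary_not_extremum[OF assms] by (intro ex1I[of _ "- k / 2 - a / 4"]) auto
qed

section \<open>The differential equation\<close>

lemma flow_solution_exists:
  assumes "k \<noteq> 0"
  shows "\<exists>x. flow_solution a b T x \<and> x T = - a / 4 - k / 2"
proof -
  \<comment> \<open>The explicit solution follows the zero \<open>- k * w t\<close> of
    \<open>rho (T - t)\<close>.\<close>
  define w where "w t = inv_branch ((T - t) / k^2)" for t
  define x where "x t = - a / 4 - k * w t" for t
  have wpos: "w t > 0" and bw: "k^2 * branch (w t) = T - t" for t
    using assms by (auto simp: w_def inv_branch)
  have "w T = 1 / 2"
    using inv_branch_branch[of "1 / 2"] by (simp add: w_def branch_half)
  then have xT: "x T = - a / 4 - k / 2" by (simp add: x_def)
  have "flow_solution a b T x"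
    unfolding flow_solution_def
  proof (intro ballI conjI)
    fix t assume "t \<in> {0..T}"
    define h' where "h' = 2 * w t / 3 + 1 / (96 * (w t)^2)"
    have h': "h' > 0" unfolding h'_def using wpos[of t] by (intro add_pos_pos) auto
    \<comment> \<open>The denominator is a positive multiple of \<open>h'\<close>, the derivative of
      \<open>branch\<close> at \<open>w t\<close>, so it cannot vanish.\<close>
    have den: "12 * (x t)^2 + 6 * a * x t + 2 * b + 12 * t = 12 * k^2 * w t * h'"
      unfolding denominator_shift bw[symmetric] using wpos[of t]
      by (simp add: x_def branch_def h'_def field_simps power2_eq_square power3_eq_cube)
    then show "12 * (x t)^2 + 6 * a * x t + 2 * b + 12 * t \<noteq> 0"
      using assms wpos[of t] h' by simp
    have "DERIV w t :> inverse h' * (- 1 / k^2)"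
      unfolding w_def h'_def
      by (rule DERIV_chain2[OF DERIV_inv_branch], rule DERIV_cdivide) (auto intro!: derivative_eq_intros)
    then have "DERIV x t :> - (k * (inverse h' * (- 1 / k^2)))"
      unfolding x_def by (auto intro!: derivative_eq_intros)
    moreover have "- (k * (inverse h' * (- 1 / k^2))) = 1 / (k * h')"
      using assms by (simp add: divide_inverse power2_eq_square)
    moreover have "1 / (k * h') = - ((12 * x t + 3 * a) / (12 * (x t)^2 + 6 * a * x t + 2 * b + 12 * t))"
    proof -
      have num: "12 * x t + 3 * a = - (12 * k * w t)" by (simp add: x_def)
      show ?thesis unfolding den num using assms wpos[of t] h'
        by (simp add: field_simps power2_eq_square)
    qed
    ultimately show "(x has_real_derivative
        - ((12 * x t + 3 * a) / (12 * (x t)^2 + 6 * a * x t + 2 * b + 12 * t))) (at t within {0..T})"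
      by (simp add: has_field_derivative_at_within)
  qed
  with xT show ?thesis by blast
qed

lemma flow_solution_minimizer:
  assumes "k \<noteq> 0" "T > 0" and sol: "flow_solution a b T x" and xT: "x T = - a / 4 - k / 2"
  shows "global_minimizers (quartic a b c d) = {x 0}"
proof -
  define z where "z t = x t + a / 4" for t
  define D where "D t = 12 * (z t)^2 - 12 * (T - t) - 3 * k^2 / 4" for t
  define E where "E t = rho (T - t) (z t)" for t
  have num: "12 * x t + 3 * a = 12 * z t" for t by (simp add: z_def)
  have D: "D t \<noteq> 0" and dx: "(x has_real_derivative - (12 * z t / D t)) (at t within {0..T})"
    if "t \<in> {0..T}" for t
    using sol that unfolding flow_solution_def denominator_shift num D_def z_def by auto
  have dz: "(z has_real_derivative - (12 * z t / D t)) (at t within {0..T})" if "t \<in> {0..T}" for t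
    unfolding z_def using dx[OF that] by (auto intro!: derivative_eq_intros simp: z_def)
  have dE: "(E has_real_derivative 0) (at t within {0..T})" if "t \<in> {0..T}" for t
  proof -
    define z' where "z' = - (12 * z t / D t)"
    have dz': "(z has_real_derivative z') (at t within {0..T})"
      unfolding z'_def by (rule dz[OF that])
    \<comment> \<open>The first term comes from the motion of \<open>z\<close>, the second from the
      explicit dependence on \<open>t\<close>; the equation makes them cancel.\<close>
    have "(E has_real_derivative D t * z' + 12 * z t) (at t within {0..T})"
      unfolding E_def rho_def
      by (rule derivative_eq_intros refl dz')+ (simp add: D_def algebra_simps)
    then show ?thesis using D[OF that] by (simp add: z'_def)
  qed
  have contE: "continuous_on {0..T} E" and contz: "continuous_on {0..T} z"
    by (rule DERIV_continuous_on, erule dE) (rule DERIV_continuous_on, erule dz)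
  have const: "E t = E 0" if "0 \<le> t" "t \<le> T" for t
  proof (rule DERIV_isconst2[OF assms(2) contE _ that])
    fix t assume "0 < t" "t < T"
    then show "DERIV E t :> 0" using dE[of t] by (simp add: at_within_Icc_at)
  qed
  have zT: "z T = - k / 2" by (simp add: z_def xT)
  have "E T = 0"
    unfolding E_def zT by (simp add: rho_def power2_eq_square power3_eq_cube)
  then have E0: "E t = 0" if "0 \<le> t" "t \<le> T" for t
    using const[OF that] const[of T] assms(2) by simp
  have nz: "z t \<noteq> 0" if "0 \<le> t" "t \<le> T" for t
    using E0[OF that] assms(1) by (auto simp: E_def rho_def)
  \<comment> \<open>At \<open>T\<close> the product is \<open>- k^2 / 2\<close>; a change of sign
    would force a zero of \<open>z\<close>.\<close>
  have "z 0 * k < 0"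
  proof (rule ccontr)
    assume "\<not> z 0 * k < 0"
    moreover have "z T * k \<le> 0" by (simp add: zT)
    moreover have "continuous_on {0..T} (\<lambda>t. z t * k)" by (intro continuous_intros contz)
    ultimately obtain t where "0 \<le> t" "t \<le> T" "z t * k = 0"
      using IVT2'[of "\<lambda>t. z t * k" T 0 0] assms(2) by auto
    then show False using nz assms(1) by simp
  qed
  moreover have "rho T (z 0) = 0" using E0[of 0] assms(2) by (simp add: E_def)
  ultimately show ?thesis using global_minimizers_opposite[of "z 0"] by (simp add: z_def)
qed

section \<open>The symmetric case, where \<open>p\<close> is even about
  \<open>- a / 4\<close>\<close>

lemma symmetric_case:
  assumes k: "k = 0" and "T > 0"
  shows "card (global_minimizers (quartic a b c d)) = 2"
    "degree (pderiv (quartic a b c d) div [:a / 4, 1:]) = 2"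
    "global_minimizers (quartic a b c d) =
      {x. poly (pderiv (quartic a b c d) div [:a / 4, 1:]) x = 0}"
proof -
  let ?p = "quartic a b c d"
  define r where "r = [:a^2 / 4 - 12 * T, 2 * a, 4:]"
  have "pderiv ?p = [:a / 4, 1:] * r"
    unfolding quartic_def c_eq r_def
    by (simp add: pderiv_pCons b_eq k field_simps power2_eq_square power3_eq_cube)
  moreover have "[:a / 4, 1:] \<noteq> 0" by simp
  ultimately have quot: "pderiv ?p div [:a / 4, 1:] = r"
    by (metis nonzero_mult_div_cancel_left)
  then show "degree (pderiv ?p div [:a / 4, 1:]) = 2" by (simp add: r_def)
  \<comment> \<open>The constant left after completing the square in \<open>(x + a / 4)^2\<close>,
    and thus the minimum of \<open>p\<close>.\<close>
  define e where "e = poly ?p (- a / 4) - 9 * T^2"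
  have val: "poly ?p x = ((x + a / 4)^2 - 3 * T)^2 + e" for x
    unfolding e_def using poly_shift[of "x + a / 4"] k by (simp add: field_simps power2_eq_square power4_eq_xxxx)
  define u where "u = sqrt (3 * T) - a / 4"
  have u: "(u + a / 4)^2 = 3 * T" using assms(2) by (simp add: u_def)
  have min: "global_minimizers ?p = {x. (x + a / 4)^2 = 3 * T}"
  proof (intro set_eqI iffI)
    fix x assume "x \<in> global_minimizers ?p"
    then have "poly ?p x \<le> poly ?p u" by (simp add: global_minimizers_def)
    then have "((x + a / 4)^2 - 3 * T)^2 \<le> 0" unfolding val[of x] val[of u] u by simp
    then show "x \<in> {x. (x + a / 4)^2 = 3 * T}" by simp
  next
    fix x assume "x \<in> {x. (x + a / 4)^2 = 3 * T}"
    then show "x \<in> global_minimizers ?p"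
      unfolding global_minimizers_def val by simp
  qed
  have "poly r x = 4 * ((x + a / 4)^2 - 3 * T)" for x
    by (simp add: r_def field_simps power2_eq_square)
  then show "global_minimizers ?p = {x. poly (pderiv ?p div [:a / 4, 1:]) x = 0}"
    unfolding quot min by simp
  have "(x + a / 4)^2 = 3 * T \<longleftrightarrow> x = sqrt (3 * T) - a / 4 \<or> x = - sqrt (3 * T) - a / 4" for x
    using power2_eq_iff[of "x + a / 4" "sqrt (3 * T)"] assms(2) by auto
  then have "global_minimizers ?p = {sqrt (3 * T) - a / 4, - sqrt (3 * T) - a / 4}"
    unfolding min by auto
  then show "card (global_minimizers ?p) = 2" using assms(2) by simp
qed

text \<open>At the centre only the constant term \<open>k^3 / 8\<close> of \<open>rho\<close>
  survives. This turns the case split of the theorem into one on \<open>k\<close>.\<close>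

lemma neg_quarter_critical: "- a / 4 \<in> critical_points (quartic a b c d) \<longleftrightarrow> k = 0"
proof -
  have "poly (pderiv (quartic a b c d)) (- a / 4) = k^3 / 8"
    using poly_pderiv_shift[of 0] unfolding rho_def by simp
  then have "poly (pderiv (quartic a b c d)) (- a / 4) = 0 \<longleftrightarrow> k^3 / 8 = 0" by (simp only:)
  then show ?thesis by (simp add: critical_points_def)
qed

end

text \<open>The conditional isolates the boundary case, in which uniqueness holds for the critical
  point that is a local extremum. The existence clause keeps the claim about all solutions from
  being vacuous.\<close>

theorem theorem4p10:
  fixes a b c d :: real and p :: "real poly" and T :: real
  assumes p: "p = quartic a b c d"
    and T: "T = t_u a b c"
  shows
    "(T \<le> 0 \<longrightarrow>
        (if T = 0 \<and> cubic_coeff a b c \<noteq> 0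
         then card (critical_points p) = 2 \<and> (\<exists>!x. x \<in> critical_points p \<and> local_extremum p x)
         else card (critical_points p) = 1)) \<and>
     (T > 0 \<longrightarrow>
        card (critical_points p) = 3 \<and>
        ((\<forall>x\<in>critical_points p. x \<noteq> - a / 4) \<longrightarrow>
           (\<exists>x. flow_solution a b T x \<and> x T = - a / 4 - root 3 (cubic_coeff a b c) / 2) \<and>
           (\<forall>x. flow_solution a b T x \<and> x T = - a / 4 - root 3 (cubic_coeff a b c) / 2 \<longrightarrow>
              global_minimizers p = {x 0})) \<and>
        (- a / 4 \<in> critical_points p \<longrightarrow>
           card (global_minimizers p) = 2 \<and>
           degree (pderiv p div [:a / 4, 1:]) = 2 \<and>
           global_minimizers p = {x. poly (pderiv p div [:a / 4, 1:]) x = 0}))"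
proof -
  define k where "k = root 3 (cubic_coeff a b c)"
  interpret depressed a b c d k T by unfold_locales (simp_all add: k_def T)
  have k0: "cubic_coeff a b c = 0 \<longleftrightarrow> k = 0" by (simp add: k_def)
  have nc: "(\<forall>x\<in>critical_points p. x \<noteq> - a / 4) \<longleftrightarrow> k \<noteq> 0"
    using neg_quarter_critical unfolding p by blast
  have "card {- k / 2, k / 4} = 2" if "k \<noteq> 0" using that by simp
  then have two: "T = 0 \<Longrightarrow> k \<noteq> 0 \<Longrightarrow> card (critical_points p) = 2"
    unfolding p card_critical_points using boundary_zeros by simp
  have one: "card (critical_points p) = 1" if "T \<le> 0" "\<not> (T = 0 \<and> k \<noteq> 0)"
    unfolding p card_critical_points using that by (intro card_zeros_one) auto
  have three: "T > 0 \<Longrightarrow> card (critical_points p) = 3"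
    unfolding p card_critical_points by (rule card_zeros_three)
  show ?thesis
    unfolding nc k0 k_def[symmetric]
    using one two three boundary_unique_extremum flow_solution_exists flow_solution_minimizer
      symmetric_case neg_quarter_critical unfolding p by auto
qed

end
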